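(* Let $X_n=\{x_1,\dots,x_n\}$ be a finite space with $n$ points, let $B=C(X_n)$, and let $\alpha:B\to B\otimes A$ be an action of a compact quantum group $\mathcal{G}=(A,\Delta)$ on $B$. Let $e_j\in B$ be the characteristic function of $\{x_j\}$, let $ev_i:B\to\mathbb{C}$ be evaluation at $x_i$, and put $a_{ij}=(ev_i\otimes id)\alpha(e_j)\in A$ for $1\le i,j\le n$. The following are equivalent: (1) The action $\alpha$ is ergodic. (2) $h(a_{ij})=\frac1n$ for the Haar measure $h$ of $\mathcal{G}$ and all $1\le i,j\le n$. (3) All $a_{ij}$, $1\le i,j\le n$, are nonzero. (4) Every $\alpha$-invariant state $\psi$ on $B$ satisfies $\psi(e_i)=\frac1n$ for all $1\le i\le n$.
   Context: $\otimes$ denotes the minimal tensor product of $C^*$-algebras. A compact quantum group $\mathcal{G}$ is a pair $(A,\Delta)$ with $A$ a unital $C^*$-algebra and $\Delta:A\to A\otimes A$ a unital $*$-homomorphism such that $(id\otimes\Delta)\Delta=(\Delta\otimes id)\Delta$ and the linear spans of $\Delta(A)(1\otimes A)$ and of $\Delta(A)(A\otimes 1)$ are dense in $A\otimes A$. Its Haar measure is the unique state $h$ on $A$ with $(h\otimes id)\Delta(a)=(id\otimes h)\Delta(a)=h(a)1_A$ for all $a\in A$. An action of $\mathcal{G}$ on a unital $C^*$-algebra $B$ is a unital $*$-homomorphism $\alpha:B\to B\otimes A$ with $(\alpha\otimes id)\alpha=(id\otimes\Delta)\alpha$ and such that the linear span of $\alpha(B)(1\otimes A)$ is dense in $B\otimes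 A$. The action is ergodic if $\{b\in B:\alpha(b)=b\otimes 1\}=\mathbb{C}1_B$. A state $\psi$ on $B$ is $\alpha$-invariant if $(\psi\otimes id)\alpha(b)=\psi(b)1_A$ for all $b\in B$. *)

theory Defs
  imports "HOL-Analysis.Analysis"
begin

section \<open>Unital C*-algebras\<close>

text \<open>
  The class \<^class>\<open>real_normed_algebra_1\<close> contains the axiom \<open>norm 1 = 1\<close>, which for a unital
  C*-algebra says exactly that the algebra is nonzero.
\<close>

class cstar_algebra_1 = real_normed_algebra_1 + banach +
  fixes scaleC :: "complex \<Rightarrow> 'a \<Rightarrow> 'a"  (infixr \<open>*\<^sub>C\<close> 75)
    and star :: "'a \<Rightarrow> 'a"
  assumes scaleC_add_right: "c *\<^sub>C (x + y) = c *\<^sub>C x + c *\<^sub>C y"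
    and scaleC_add_left: "(c + d) *\<^sub>C x = c *\<^sub>C x + d *\<^sub>C x"
    and scaleC_scaleC: "c *\<^sub>C d *\<^sub>C x = (c * d) *\<^sub>C x"
    and scaleC_of_real: "complex_of_real r *\<^sub>C x = r *\<^sub>R x"
    and mult_scaleC_left: "(c *\<^sub>C x) * y = c *\<^sub>C (x * y)"
    and mult_scaleC_right: "x * (c *\<^sub>C y) = c *\<^sub>C (x * y)"
    and norm_scaleC: "norm (c *\<^sub>C x) = cmod c * norm x"
    and star_star: "star (star x) = x"
    and star_add: "star (x + y) = star x + star y"
    and star_scaleC: "star (c *\<^sub>C x) = cnj c *\<^sub>C star x"
    and star_mult: "star (x * y) = star y * star x"
    and cstar_identity: "norm (star x * x) = (norm x)\<^sup>2"

global_interpretation complex_space: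
  vector_space "scaleC :: complex \<Rightarrow> 'a \<Rightarrow> 'a::cstar_algebra_1"
  defines cspan = complex_space.span
    and cdependent = complex_space.dependent
proof
  show "1 *\<^sub>C x = x" for x :: 'a
    using scaleC_of_real[of 1 x] by simp
qed (simp_all add: scaleC_add_right scaleC_add_left scaleC_scaleC)

abbreviation clinear :: "('a::cstar_algebra_1 \<Rightarrow> 'b::cstar_algebra_1) \<Rightarrow> bool" where
  "clinear \<equiv> Vector_Spaces.linear scaleC scaleC"

definition unital_star_hom :: "('a::cstar_algebra_1 \<Rightarrow> 'b::cstar_algebra_1) \<Rightarrow> bool" where
  "unital_star_hom f \<longleftrightarrow> clinear f \<and> (\<forall>x y. f (x * y) = f x * f y) \<and>
     (\<forall>x. f (star x) = star (f x)) \<and> f 1 = 1"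


instantiation complex :: cstar_algebra_1
begin

definition scaleC_complex :: "complex \<Rightarrow> complex \<Rightarrow> complex" where
  "scaleC_complex = (*)"

definition star_complex :: "complex \<Rightarrow> complex" where
  "star_complex = cnj"

instance
  by standard (simp_all add: scaleC_complex_def star_complex_def algebra_simps norm_mult
      power2_eq_square scaleR_conv_of_real)

end

definition state :: "('a::cstar_algebra_1 \<Rightarrow> complex) \<Rightarrow> bool" where
  "state \<phi> \<longleftrightarrow> clinear \<phi> \<and> (\<forall>x. \<phi> (star x * x) \<in> \<real>\<^sub>\<ge>\<^sub>0) \<and> \<phi> 1 = 1"


section \<open>The algebra of functions on a finite discrete space\<close>

typedef 'x cfun = "UNIV :: ('x::finite \<Rightarrow> complex) set"
  morphisms eval_cfun Cfun ..

setup_lifting type_definition_cfun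

lemma cfun_eqI: "(\<And>x. eval_cfun f x = eval_cfun g x) \<Longrightarrow> f = g"
  by transfer auto

instantiation cfun :: (finite) real_normed_algebra_1
begin

lift_definition zero_cfun :: "'a cfun" is "\<lambda>_. 0" .
lift_definition one_cfun :: "'a cfun" is "\<lambda>_. 1" .
lift_definition plus_cfun :: "'a cfun \<Rightarrow> 'a cfun \<Rightarrow> 'a cfun" is "\<lambda>f g x. f x + g x" .
lift_definition minus_cfun :: "'a cfun \<Rightarrow> 'a cfun \<Rightarrow> 'a cfun" is "\<lambda>f g x. f x - g x" .
lift_definition uminus_cfun :: "'a cfun \<Rightarrow> 'a cfun" is "\<lambda>f x. - f x" .
lift_definition times_cfun :: "'a cfun \<Rightarrow> 'a cfun \<Rightarrow> 'a cfun" is "\<lambda>f g x. f x * g x" .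
lift_definition scaleR_cfun :: "real \<Rightarrow> 'a cfun \<Rightarrow> 'a cfun" is "\<lambda>r f x. r *\<^sub>R f x" .
lift_definition norm_cfun :: "'a cfun \<Rightarrow> real" is "\<lambda>f. MAX x. cmod (f x)" .

definition "sgn_cfun (f :: 'a cfun) = scaleR (inverse (norm f)) f"
definition "dist_cfun (f :: 'a cfun) g = norm (f - g)"
definition "uniformity_cfun = (INF e\<in>{0 <..}. principal {(f :: 'a cfun, g). dist f g < e})"
definition "open_cfun (S :: 'a cfun set) =
  (\<forall>f\<in>S. \<forall>\<^sub>F (f', g) in uniformity. f' = f \<longrightarrow> g \<in> S)"

lemma cmod_le_norm_cfun: "cmod (eval_cfun f x) \<le> norm (f :: 'a cfun)"
  by transfer simp

lemma norm_cfun_le: "(\<And>x. cmod (eval_cfun f x) \<le> b) \<Longrightarrow> norm (f :: 'a cfun) \<le> b"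
  by transfer simp

lemma norm_cfun_attained: "\<exists>x. norm (f :: 'a cfun) = cmod (eval_cfun f x)"
proof transfer
  fix f :: "'a \<Rightarrow> complex"
  have "(MAX x. cmod (f x)) \<in> range (\<lambda>x. cmod (f x))"
    by (rule Max_in) auto
  then show "\<exists>x. (MAX x. cmod (f x)) = cmod (f x)"
    by blast
qed

lemma norm_cfun_scale:
  assumes kl: "\<And>x. eval_cfun k x = c * eval_cfun l x"
  shows "norm (k :: 'a cfun) = cmod c * norm l"
proof (rule antisym)
  show "norm k \<le> cmod c * norm l"
    by (rule norm_cfun_le) (simp add: kl norm_mult mult_left_mono cmod_le_norm_cfun)
  obtain x where "norm l = cmod (eval_cfun l x)" using norm_cfun_attained by blast
  then show "cmod c * norm l \<le> norm k"
    using cmod_le_norm_cfun[of k x] by (simp add: kl norm_mult)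
qed

instance
proof
  fix f g h :: "'a cfun" and r s :: real
  show "dist f g = norm (f - g)" by (simp add: dist_cfun_def)
  show "sgn f = scaleR (inverse (norm f)) f" by (simp add: sgn_cfun_def)
  show "f + g + h = f + (g + h)" by transfer (simp add: algebra_simps)
  show "f + g = g + f" by transfer (simp add: algebra_simps)
  show "0 + f = f" by transfer simp
  show "- f + f = 0" by transfer simp
  show "f - g = f + - g" by transfer simp
  show "r *\<^sub>R (f + g) = r *\<^sub>R f + r *\<^sub>R g" by transfer (simp add: algebra_simps)
  show "(r + s) *\<^sub>R f = r *\<^sub>R f + s *\<^sub>R f" by transfer (simp add: algebra_simps)
  show "r *\<^sub>R s *\<^sub>R f = (r * s) *\<^sub>R f" by transfer simp
  show "1 *\<^sub>R f = f" by transfer simp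
  show "f * g * h = f * (g * h)" by transfer (simp add: algebra_simps)
  show "(f + g) * h = f * h + g * h" by transfer (simp add: algebra_simps)
  show "f * (g + h) = f * g + f * h" by transfer (simp add: algebra_simps)
  show "r *\<^sub>R f * g = r *\<^sub>R (f * g)" by transfer simp
  show "f * r *\<^sub>R g = r *\<^sub>R (f * g)" by transfer simp
  show "1 * f = f" by transfer simp
  show "f * 1 = f" by transfer simp
  show "(0 :: 'a cfun) \<noteq> 1" by transfer (simp add: fun_eq_iff)
  show "uniformity = (INF e\<in>{0 <..}. principal {(f :: 'a cfun, g). dist f g < e})"
    by (rule uniformity_cfun_def)
  show "open S = (\<forall>f\<in>S. \<forall>\<^sub>F (f', g) in uniformity. f' = f \<longrightarrow> g \<in> S)" for S :: "'a cfun set"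
    by (rule open_cfun_def)
  show "norm f = 0 \<longleftrightarrow> f = 0"
  proof
    assume "norm f = 0"
    then have "eval_cfun f x = 0" for x
      using cmod_le_norm_cfun[of f x] by simp
    then show "f = 0" by (intro cfun_eqI) (simp add: zero_cfun.rep_eq)
  next
    assume "f = 0" then show "norm f = 0" by (simp add: norm_cfun.rep_eq zero_cfun.rep_eq)
  qed
  show "norm (f + g) \<le> norm f + norm g"
    by (rule norm_cfun_le)
      (simp add: plus_cfun.rep_eq norm_triangle_le add_mono cmod_le_norm_cfun)
  show "norm (r *\<^sub>R f) = \<bar>r\<bar> * norm f"
    using norm_cfun_scale[of "r *\<^sub>R f" "complex_of_real r" f]
    by (simp add: scaleR_cfun.rep_eq scaleR_conv_of_real)
  show "norm (f * g) \<le> norm f * norm g"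
    by (rule norm_cfun_le)
      (simp add: times_cfun.rep_eq norm_mult mult_mono cmod_le_norm_cfun order_trans[OF norm_ge_zero cmod_le_norm_cfun])
  show "norm (1 :: 'a cfun) = 1" by (simp add: norm_cfun.rep_eq one_cfun.rep_eq)
qed

end

instance cfun :: (finite) banach
proof
  fix X :: "nat \<Rightarrow> 'a cfun"
  assume "Cauchy X"
  have le: "dist (eval_cfun (X m) x) (eval_cfun (X n) x) \<le> dist (X m) (X n)" for m n x
    using cmod_le_norm_cfun[of "X m - X n" x]
    by (simp add: dist_cfun_def dist_norm minus_cfun.rep_eq)
  have "Cauchy (\<lambda>n. eval_cfun (X n) x)" for x
    unfolding Cauchy_def
  proof (intro allI impI)
    fix e :: real
    assume "0 < e"
    then obtain M where "\<And>m n. m \<ge> M \<Longrightarrow> n \<ge> M \<Longrightarrow> dist (X m) (X n) < e"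
      using \<open>Cauchy X\<close> unfolding Cauchy_def by blast
    then have "dist (eval_cfun (X m) x) (eval_cfun (X n) x) < e" if "m \<ge> M" "n \<ge> M" for m n
      using le_less_trans[OF le] that by blast
    then show "\<exists>M. \<forall>m\<ge>M. \<forall>n\<ge>M. dist (eval_cfun (X m) x) (eval_cfun (X n) x) < e"
      by blast
  qed
  then have "\<forall>x. \<exists>l. (\<lambda>n. eval_cfun (X n) x) \<longlonglongrightarrow> l"
    by (simp add: Cauchy_convergent_iff convergent_def)
  then obtain l where l: "\<And>x. (\<lambda>n. eval_cfun (X n) x) \<longlonglongrightarrow> l x"
    by metis
  have "X \<longlonglongrightarrow> Cfun l"
  proof (rule metric_LIMSEQ_I)
    fix e :: real
    assume e: "0 < e"
    have "\<forall>\<^sub>F n in sequentially. \<forall>x. dist (eval_cfun (X n) x) (l x) < e"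
      using l e by (intro eventually_all_finite) (auto simp: tendsto_iff)
    then obtain N where N: "\<And>n x. n \<ge> N \<Longrightarrow> dist (eval_cfun (X n) x) (l x) < e"
      unfolding eventually_sequentially by blast
    have "dist (X n) (Cfun l) < e" if "n \<ge> N" for n
    proof -
      obtain x where "norm (X n - Cfun l) = cmod (eval_cfun (X n - Cfun l) x)"
        using norm_cfun_attained by blast
      then show ?thesis
        using N[OF that, of x]
        by (simp add: dist_cfun_def dist_norm minus_cfun.rep_eq Cfun_inverse)
    qed
    then show "\<exists>N. \<forall>n\<ge>N. dist (X n) (Cfun l) < e" by blast
  qed
  then show "convergent X" by (rule convergentI)
qed

instantiation cfun :: (finite) cstar_algebra_1
begin

lift_definition scaleC_cfun :: "complex \<Rightarrow> 'a cfun \<Rightarrow> 'a cfun" is "\<lambda>c f x. c * f x" .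
lift_definition star_cfun :: "'a cfun \<Rightarrow> 'a cfun" is "\<lambda>f x. cnj (f x)" .

instance
proof
  fix f g :: "'a cfun" and r :: real and c d :: complex
  show "norm (c *\<^sub>C f) = cmod c * norm f"
    by (rule norm_cfun_scale) (simp add: scaleC_cfun.rep_eq)
  show "c *\<^sub>C (f + g) = c *\<^sub>C f + c *\<^sub>C g" by transfer (simp add: algebra_simps)
  show "(c + d) *\<^sub>C f = c *\<^sub>C f + d *\<^sub>C f" by transfer (simp add: algebra_simps)
  show "c *\<^sub>C d *\<^sub>C f = (c * d) *\<^sub>C f" by transfer (simp add: algebra_simps)
  show "complex_of_real r *\<^sub>C f = r *\<^sub>R f" by transfer (simp add: scaleR_conv_of_real)
  show "(c *\<^sub>C f) * g = c *\<^sub>C (f * g)" by transfer (simp add: algebra_simps)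
  show "f * (c *\<^sub>C g) = c *\<^sub>C (f * g)" by transfer (simp add: algebra_simps)
  show "star (star f) = f" by transfer simp
  show "star (f + g) = star f + star g" by transfer simp
  show "star (c *\<^sub>C f) = cnj c *\<^sub>C star f" by transfer simp
  show "star (f * g) = star g * star f" by transfer (simp add: algebra_simps)
  show "norm (star f * f) = (norm f)\<^sup>2"
  proof (rule antisym)
    show "norm (star f * f) \<le> (norm f)\<^sup>2"
      by (rule norm_cfun_le)
        (simp add: times_cfun.rep_eq star_cfun.rep_eq norm_mult power2_eq_square mult_mono
          cmod_le_norm_cfun order_trans[OF norm_ge_zero cmod_le_norm_cfun])
    obtain x where "norm f = cmod (eval_cfun f x)" using norm_cfun_attained by blast
    then show "(norm f)\<^sup>2 \<le> norm (star f * f)"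
      using cmod_le_norm_cfun[of "star f * f" x]
      by (simp add: times_cfun.rep_eq star_cfun.rep_eq norm_mult power2_eq_square)
  qed
qed

end

definition char_cfun :: "'x::finite \<Rightarrow> 'x cfun" where
  "char_cfun j = Cfun (\<lambda>i. if i = j then 1 else 0)"

abbreviation ev :: "'x::finite \<Rightarrow> 'x cfun \<Rightarrow> complex" where
  "ev i \<equiv> \<lambda>f. eval_cfun f i"


section \<open>The minimal tensor product\<close>

definition cstar_norm_on :: "'t::cstar_algebra_1 set \<Rightarrow> ('t \<Rightarrow> real) \<Rightarrow> bool" where
  "cstar_norm_on V N \<longleftrightarrow>
     (\<forall>x\<in>V. 0 \<le> N x \<and> (N x = 0 \<longleftrightarrow> x = 0) \<and> N (star x * x) = (N x)\<^sup>2) \<and>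
     (\<forall>x\<in>V. \<forall>y\<in>V. N (x + y) \<le> N x + N y \<and> N (x * y) \<le> N x * N y) \<and>
     (\<forall>c. \<forall>x\<in>V. N (c *\<^sub>C x) = cmod c * N x)"

text \<open>
  \<open>min_tensor tens\<close> says that the type \<open>'t\<close>, with the elementary tensors \<open>tens a b\<close>, is the
  minimal tensor product of \<open>'a\<close> and \<open>'b\<close>. By \<open>tens_inj\<close> the linear span of the elementary
  tensors is the algebraic tensor product, a *-algebra by \<open>tens_mult\<close> and \<open>tens_star\<close>; and \<open>'t\<close>
  is its completion in the least of all C*-norms on it (by Takesaki's theorem, the spatial norm). These conditions determine \<open>'t\<close> up to a
  unique isomorphism that respects elementary tensors.
\<close>

locale min_tensor =
  fixes tens :: "'a::cstar_algebra_1 \<Rightarrow> 'b::cstar_algebra_1 \<Rightarrow> 't::cstar_algebra_1"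
  assumes tens_linear_left: "clinear (\<lambda>a. tens a b)"
    and tens_linear_right: "clinear (\<lambda>b. tens a b)"
    and tens_mult: "tens a b * tens a' b' = tens (a * a') (b * b')"
    and tens_star: "star (tens a b) = tens (star a) (star b)"
    and tens_one: "tens 1 1 = 1"
    and tens_inj: "\<lbrakk>finite S; \<not> cdependent S; (\<Sum>b\<in>S. tens (f b) b) = 0; b \<in> S\<rbrakk> \<Longrightarrow> f b = 0"
    and tens_dense: "closure (cspan {tens a b |a b. True}) = UNIV"
    and tens_minimal: "\<lbrakk>cstar_norm_on (cspan {tens a b |a b. True}) N;
      x \<in> cspan {tens a b |a b. True}\<rbrakk> \<Longrightarrow> norm x \<le> N x"

text \<open>
  \<open>tensor_map tens tens' f g F\<close> says that \<open>F\<close> is the map \<open>f \<otimes> g\<close>; by density there is at most one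
  such \<open>F\<close>, and for *-homomorphisms and states \<open>f\<close>, \<open>g\<close> there is one. If \<open>f\<close> or \<open>g\<close> is a functional, we identify \<open>\<complex> \<otimes> B\<close> with \<open>B\<close> and \<open>A \<otimes> \<complex>\<close> with \<open>A\<close>,
  that is, we take \<open>tens'\<close> to be one of the two scalar multiplications \<open>tens_C_left\<close> and
  \<open>tens_C_right\<close>.
\<close>

definition tensor_map ::
  "('a::cstar_algebra_1 \<Rightarrow> 'b::cstar_algebra_1 \<Rightarrow> 't::cstar_algebra_1) \<Rightarrow>
   ('c::cstar_algebra_1 \<Rightarrow> 'd::cstar_algebra_1 \<Rightarrow> 's::cstar_algebra_1) \<Rightarrow>
   ('a \<Rightarrow> 'c) \<Rightarrow> ('b \<Rightarrow> 'd) \<Rightarrow> ('t \<Rightarrow> 's) \<Rightarrow> bool" where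
  "tensor_map tens tens' f g F \<longleftrightarrow>
     clinear F \<and> continuous_on UNIV F \<and> (\<forall>a b. F (tens a b) = tens' (f a) (g b))"

definition tens_C_left :: "complex \<Rightarrow> 'b \<Rightarrow> 'b::cstar_algebra_1" where
  "tens_C_left c b = c *\<^sub>C b"

definition tens_C_right :: "'a \<Rightarrow> complex \<Rightarrow> 'a::cstar_algebra_1" where
  "tens_C_right a c = c *\<^sub>C a"

text \<open>
  A triple tensor product \<open>A \<otimes> B \<otimes> C\<close> is one algebra that is both \<open>(A \<otimes> B) \<otimes> C\<close> (via \<open>tensL\<close>) and
  \<open>A \<otimes> (B \<otimes> C)\<close> (via \<open>tensR\<close>).
\<close>

definition triple_tensor ::
  "('a::cstar_algebra_1 \<Rightarrow> 'b::cstar_algebra_1 \<Rightarrow> 'ab::cstar_algebra_1) \<Rightarrow>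
   ('b \<Rightarrow> 'c::cstar_algebra_1 \<Rightarrow> 'bc::cstar_algebra_1) \<Rightarrow>
   ('ab \<Rightarrow> 'c \<Rightarrow> 'abc::cstar_algebra_1) \<Rightarrow> ('a \<Rightarrow> 'bc \<Rightarrow> 'abc) \<Rightarrow> bool" where
  "triple_tensor tensAB tensBC tensL tensR \<longleftrightarrow>
     min_tensor tensAB \<and> min_tensor tensBC \<and> min_tensor tensL \<and> min_tensor tensR \<and>
     (\<forall>a b c. tensL (tensAB a b) c = tensR a (tensBC b c))"


section \<open>Compact quantum groups and their actions\<close>

text \<open>
  Below, \<open>tens\<close> is the tensor product \<open>A \<otimes> A\<close>, and \<open>tensL\<close>, \<open>tensR\<close> form the triple tensor product
  \<open>A \<otimes> A \<otimes> A\<close>; for an action, \<open>tensB\<close> is \<open>B \<otimes> A\<close> and \<open>tensBL\<close>, \<open>tensBR\<close> form \<open>B \<otimes> A \<otimes> A\<close>.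
\<close>

definition compact_quantum_group ::
  "('a::cstar_algebra_1 \<Rightarrow> 'a \<Rightarrow> 'aa::cstar_algebra_1) \<Rightarrow>
   ('aa \<Rightarrow> 'a \<Rightarrow> 'aaa::cstar_algebra_1) \<Rightarrow> ('a \<Rightarrow> 'aa \<Rightarrow> 'aaa) \<Rightarrow> ('a \<Rightarrow> 'aa) \<Rightarrow> bool" where
  "compact_quantum_group tens tensL tensR \<Delta> \<longleftrightarrow>
     triple_tensor tens tens tensL tensR \<and>
     unital_star_hom \<Delta> \<and>
     (\<exists>F G. tensor_map tens tensR id \<Delta> F \<and> tensor_map tens tensL \<Delta> id G \<and>
        (\<forall>a. F (\<Delta> a) = G (\<Delta> a))) \<and>
     closure (cspan {\<Delta> a * tens 1 b |a b. True}) = UNIV \<and>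
     closure (cspan {\<Delta> a * tens b 1 |a b. True}) = UNIV"

definition haar_measure ::
  "('a::cstar_algebra_1 \<Rightarrow> 'a \<Rightarrow> 'aa::cstar_algebra_1) \<Rightarrow> ('a \<Rightarrow> 'aa) \<Rightarrow> ('a \<Rightarrow> complex) \<Rightarrow> bool"
  where
  "haar_measure tens \<Delta> h \<longleftrightarrow>
     state h \<and>
     (\<exists>F G. tensor_map tens tens_C_left h id F \<and> tensor_map tens tens_C_right id h G \<and>
        (\<forall>a. F (\<Delta> a) = h a *\<^sub>C 1 \<and> G (\<Delta> a) = h a *\<^sub>C 1))"

definition cqg_action ::
  "('a::cstar_algebra_1 \<Rightarrow> 'a \<Rightarrow> 'aa::cstar_algebra_1) \<Rightarrow> ('a \<Rightarrow> 'aa) \<Rightarrow>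
   ('b::cstar_algebra_1 \<Rightarrow> 'a \<Rightarrow> 'ba::cstar_algebra_1) \<Rightarrow>
   ('ba \<Rightarrow> 'a \<Rightarrow> 'baa::cstar_algebra_1) \<Rightarrow> ('b \<Rightarrow> 'aa \<Rightarrow> 'baa) \<Rightarrow> ('b \<Rightarrow> 'ba) \<Rightarrow> bool" where
  "cqg_action tens \<Delta> tensB tensBL tensBR \<alpha> \<longleftrightarrow>
     triple_tensor tensB tens tensBL tensBR \<and>
     unital_star_hom \<alpha> \<and>
     (\<exists>F G. tensor_map tensB tensBL \<alpha> id F \<and> tensor_map tensB tensBR id \<Delta> G \<and>
        (\<forall>b. F (\<alpha> b) = G (\<alpha> b))) \<and>
     closure (cspan {\<alpha> b * tensB 1 a |a b. True}) = UNIV"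

definition ergodic ::
  "('b::cstar_algebra_1 \<Rightarrow> 'a::cstar_algebra_1 \<Rightarrow> 'ba::cstar_algebra_1) \<Rightarrow> ('b \<Rightarrow> 'ba) \<Rightarrow> bool"
  where
  "ergodic tensB \<alpha> \<longleftrightarrow> {b. \<alpha> b = tensB b 1} = {c *\<^sub>C 1 |c. True}"

definition invariant_state ::
  "('b::cstar_algebra_1 \<Rightarrow> 'a::cstar_algebra_1 \<Rightarrow> 'ba::cstar_algebra_1) \<Rightarrow> ('b \<Rightarrow> 'ba) \<Rightarrow>
   ('b \<Rightarrow> complex) \<Rightarrow> bool" where
  "invariant_state tensB \<alpha> \<psi> \<longleftrightarrow>
     state \<psi> \<and> (\<exists>F. tensor_map tensB tens_C_left \<psi> id F \<and> (\<forall>b. F (\<alpha> b) = \<psi> b *\<^sub>C 1))"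

end

theory Submission
  imports Defs
begin

text \<open>
  Write \<open>u = (a\<^sub>i\<^sub>j)\<close> and \<open>P = (h a\<^sub>i\<^sub>j)\<close>. The coefficients are projections, orthogonal along each row
  with sum 1, and \<open>\<Delta> a\<^sub>i\<^sub>j = \<Sum>\<^sub>k a\<^sub>i\<^sub>k \<otimes> a\<^sub>k\<^sub>j\<close>, so invariance of \<open>h\<close> gives \<open>P u = P = u P\<close>. Hence the
  columns of \<open>P\<close> are fixed vectors and its rows are invariant states.

  The crucial point is that the columns of \<open>u\<close> sum to 1 as well. The density condition says that \<open>u\<close> has
  approximate right inverses \<open>w\<close>. If \<open>\<psi>\<close> is an invariant weight, then multiplying \<open>u w \<approx> 1\<close> on the left by
  \<open>\<Sum>\<^sub>k \<psi>\<^sub>k a\<^sub>k\<^sub>l\<close> and using row orthogonality gives \<open>\<psi>\<^sub>l w\<^sub>l\<^sub>i \<approx> \<psi>\<^sub>i a\<^sub>i\<^sub>l\<close>. If \<open>\<psi>\<close> has no zeros, this determines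
  \<open>w\<close>, and \<open>u w = 1\<close> yields \<open>\<psi>\<^sub>i a\<^sub>i\<^sub>j = \<psi>\<^sub>j a\<^sub>i\<^sub>j\<close>, whence \<open>\<Sum>\<^sub>i a\<^sub>i\<^sub>j = 1\<close>. For \<open>\<psi>\<close> take the
  column sums of \<open>P\<close>: were \<open>\<psi>\<^sub>i = 0\<close>, the same relation would give \<open>\<Sum>\<^sub>j a\<^sub>i\<^sub>j = 1\<close> over the zeros \<open>j\<close> of \<open>\<psi>\<close>,
  where \<open>h a\<^sub>i\<^sub>j = 0\<close>, contradicting \<open>h 1 = 1\<close>.

  A fixed vector \<open>b\<close> satisfies \<open>b\<^sub>j a\<^sub>i\<^sub>j = b\<^sub>i a\<^sub>i\<^sub>j\<close>, so it is constant when all \<open>a\<^sub>i\<^sub>j\<close> are nonzero.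
\<close>

section \<open>Matrices with orthogonal rows of idempotents\<close>

context
  fixes u :: "'x::finite \<Rightarrow> 'x \<Rightarrow> 'a::real_normed_algebra_1"
    and \<psi> :: "'x \<Rightarrow> real"
  assumes orth: "\<And>i j k. u i j * u i k = (if j = k then u i j else 0)"
    and inv: "\<And>j. (\<Sum>i\<in>UNIV. \<psi> i *\<^sub>R u i j) = \<psi> j *\<^sub>R 1"
begin

text \<open>Here \<open>w n\<close> is the \<open>i\<close>-th column of the \<open>n\<close>-th
  approximate right inverse. Multiply the \<open>k\<close>-th relation on the left by
  \<open>\<psi> k *\<^sub>R u k l\<close>, sum over \<open>k\<close>, and use invariance.\<close>

lemma approx_right_inverse_column:
  assumes w: "\<And>k. (\<lambda>n. \<Sum>j\<in>UNIV. u k j * w n j) \<longlonglongrightarrow> (if k = i then 1 else 0)"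
  shows "(\<lambda>n. \<psi> l *\<^sub>R w n l) \<longlonglongrightarrow> \<psi> i *\<^sub>R u i l"
proof -
  have pick: "u k l * (\<Sum>j\<in>UNIV. u k j * v j) = u k l * v l" for k and v :: "'x \<Rightarrow> 'a"
  proof -
    have "u k l * (\<Sum>j\<in>UNIV. u k j * v j) = (\<Sum>j\<in>UNIV. if j = l then u k l * v l else 0)"
      unfolding sum_distrib_left mult.assoc[symmetric] by (intro sum.cong) (auto simp: orth)
    then show ?thesis by simp
  qed
  have "(\<Sum>k\<in>UNIV. \<psi> k *\<^sub>R (u k l * (\<Sum>j\<in>UNIV. u k j * w n j))) = \<psi> l *\<^sub>R w n l" for n
  proof -
    have "(\<Sum>k\<in>UNIV. \<psi> k *\<^sub>R (u k l * (\<Sum>j\<in>UNIV. u k j * w n j)))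
        = (\<Sum>k\<in>UNIV. \<psi> k *\<^sub>R u k l) * w n l"
      by (simp add: pick sum_distrib_right)
    then show ?thesis by (simp add: inv)
  qed
  moreover have "(\<lambda>n. \<Sum>k\<in>UNIV. \<psi> k *\<^sub>R (u k l * (\<Sum>j\<in>UNIV. u k j * w n j)))
      \<longlonglongrightarrow> (\<Sum>k\<in>UNIV. \<psi> k *\<^sub>R (u k l * (if k = i then 1 else 0)))"
    by (intro tendsto_intros w)
  moreover have "(\<Sum>k\<in>UNIV. \<psi> k *\<^sub>R (u k l * (if k = i then 1 else 0))) = \<psi> i *\<^sub>R u i l"
  proof -
    have "(\<Sum>k\<in>UNIV. \<psi> k *\<^sub>R (u k l * (if k = i then 1 else 0)))
        = (\<Sum>k\<in>UNIV. if k = i then \<psi> i *\<^sub>R u i l else 0)"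
      by (intro sum.cong) auto
    then show ?thesis by simp
  qed
  ultimately show ?thesis by simp
qed

lemma approx_right_inverse_limit:
  assumes w: "\<And>k. (\<lambda>n. \<Sum>j\<in>UNIV. u k j * w n j) \<longlonglongrightarrow> (if k = i then 1 else 0)"
    and "\<psi> l \<noteq> 0"
  shows "(\<lambda>n. w n l) \<longlonglongrightarrow> (\<psi> i / \<psi> l) *\<^sub>R u i l"
proof -
  have "(\<lambda>n. inverse (\<psi> l) *\<^sub>R (\<psi> l *\<^sub>R w n l)) \<longlonglongrightarrow> inverse (\<psi> l) *\<^sub>R (\<psi> i *\<^sub>R u i l)"
    by (intro tendsto_intros approx_right_inverse_column w)
  then show ?thesis
    using \<open>\<psi> l \<noteq> 0\<close> by (simp add: divide_inverse mult.commute)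
qed

context
  assumes right_inverse: "\<And>i. \<exists>w. \<forall>k. (\<lambda>n. \<Sum>j\<in>UNIV. u k j * w n j)
    \<longlonglongrightarrow> (if k = i then 1 else 0)"
begin

text \<open>No limit is available for the \<open>w n l\<close> with \<open>\<psi> l = 0\<close>, but
  all others tend to 0. So the part of the product over \<open>N\<close> tends to 1, while
  \<open>1 - s\<close> annihilates it from the left.\<close>

lemma sum_null_columns:
  assumes "\<psi> i = 0"
  shows "(\<Sum>j | \<psi> j = 0. u i j) = 1"
proof -
  define N where "N = {j. \<psi> j = 0}"
  define s where "s = (\<Sum>j\<in>N. u i j)"
  obtain w where w: "\<And>k. (\<lambda>n. \<Sum>j\<in>UNIV. u k j * w n j) \<longlonglongrightarrow> (if k = i then 1 else 0)"
    using right_inverse by metis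
  have "(\<lambda>n. w n l) \<longlonglongrightarrow> 0" if "l \<in> - N" for l
    using approx_right_inverse_limit[OF w, of l] that assms by (simp add: N_def)
  then have "(\<lambda>n. \<Sum>l\<in>-N. u i l * w n l) \<longlonglongrightarrow> (\<Sum>l\<in>-N. u i l * 0)"
    by (intro tendsto_intros)
  then have "(\<lambda>n. (\<Sum>l\<in>UNIV. u i l * w n l) - (\<Sum>l\<in>-N. u i l * w n l)) \<longlonglongrightarrow> 1 - 0"
    using w[of i] by (intro tendsto_diff) auto
  moreover have "(\<Sum>l\<in>UNIV. u i l * w n l) - (\<Sum>l\<in>-N. u i l * w n l) = (\<Sum>l\<in>N. u i l * w n l)" for n
    using sum.subset_diff[of "-N" UNIV "\<lambda>l. u i l * w n l"] by (simp add: Diff_eq)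
  ultimately have "(\<lambda>n. \<Sum>l\<in>N. u i l * w n l) \<longlonglongrightarrow> 1"
    by simp
  then have "(\<lambda>n. (1 - s) * (\<Sum>l\<in>N. u i l * w n l)) \<longlonglongrightarrow> (1 - s) * 1"
    by (intro tendsto_intros)
  moreover have "(1 - s) * (\<Sum>l\<in>N. u i l * w n l) = 0" for n
  proof -
    have "s * u i l = u i l" if "l \<in> N" for l
      using that by (simp add: s_def sum_distrib_right orth if_distrib cong: if_cong)
    then have "(1 - s) * (u i l * w n l) = 0" if "l \<in> N" for l
      using that by (simp add: mult.assoc[symmetric] left_diff_distrib)
    then show ?thesis by (simp add: sum_distrib_left)
  qed
  ultimately have "1 - s = 0"
    by (simp add: LIMSEQ_const_iff)
  then show ?thesis by (simp add: s_def N_def)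
qed

lemma column_sum_eq_1:
  assumes pos: "\<And>i. \<psi> i \<noteq> 0"
  shows "(\<Sum>i\<in>UNIV. u i j) = 1"
proof -
  have const: "\<psi> i *\<^sub>R u i j = \<psi> j *\<^sub>R u i j" for i
  proof -
    obtain w where w: "\<And>k. (\<lambda>n. \<Sum>j\<in>UNIV. u k j * w n j) \<longlonglongrightarrow> (if k = i then 1 else 0)"
      using right_inverse by metis
    have "(\<lambda>n. \<Sum>l\<in>UNIV. u i l * w n l) \<longlonglongrightarrow> (\<Sum>l\<in>UNIV. u i l * ((\<psi> i / \<psi> l) *\<^sub>R u i l))"
      by (intro tendsto_intros approx_right_inverse_limit[OF w] pos)
    with w[of i] have "(\<Sum>l\<in>UNIV. u i l * ((\<psi> i / \<psi> l) *\<^sub>R u i l)) = 1"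
      using LIMSEQ_unique by fastforce
    then have "(\<Sum>l\<in>UNIV. (\<psi> i / \<psi> l) *\<^sub>R u i l) = 1"
      by (simp add: orth)
    \<comment> \<open>Left multiplication by \<open>u i j\<close> isolates the term
      \<open>l = j\<close>.\<close>
    then have "u i j = u i j * (\<Sum>l\<in>UNIV. (\<psi> i / \<psi> l) *\<^sub>R u i l)"
      by simp
    also have "\<dots> = (\<Sum>l\<in>UNIV. if l = j then (\<psi> i / \<psi> j) *\<^sub>R u i j else 0)"
      unfolding sum_distrib_left by (intro sum.cong) (auto simp: orth)
    finally have "\<psi> j *\<^sub>R u i j = \<psi> j *\<^sub>R ((\<psi> i / \<psi> j) *\<^sub>R u i j)"
      by simp
    then show ?thesis using pos[of j] by auto
  qed
  \<comment> \<open>By \<open>const\<close>, each weight \<open>\<psi> i\<close> in the invariance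
    relation becomes \<open>\<psi> j\<close> and leaves the sum.\<close>
  have "\<psi> j *\<^sub>R (\<Sum>i\<in>UNIV. u i j) = \<psi> j *\<^sub>R 1"
    by (simp add: scaleR_sum_right const[symmetric] inv)
  then show ?thesis using pos[of j] by simp
qed

end

end


section \<open>Tensor products with the functions on a finite space\<close>

lemma clinear_iff:
  "clinear f \<longleftrightarrow> (\<forall>x y. f (x + y) = f x + f y) \<and> (\<forall>c x. f (c *\<^sub>C x) = c *\<^sub>C f x)"
  by (simp add: Vector_Spaces.linear_iff complex_space.vector_space_axioms)

lemma
  assumes "clinear f"
  shows clinear_add: "f (x + y) = f x + f y"
    and clinear_scale: "f (c *\<^sub>C x) = c *\<^sub>C f x"
    and clinear_zero: "f 0 = 0"
    and clinear_diff: "f (x - y) = f x - f y"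
    and clinear_sum: "f (sum g A) = (\<Sum>i\<in>A. f (g i))"
proof -
  interpret Vector_Spaces.linear scaleC scaleC f by (rule assms)
  show "f (x + y) = f x + f y" "f (c *\<^sub>C x) = c *\<^sub>C f x" "f 0 = 0" "f (x - y) = f x - f y"
    "f (sum g A) = (\<Sum>i\<in>A. f (g i))"
    by (simp_all add: add scale zero diff sum)
qed

lemma star_zero [simp]: "star 0 = (0::'a::cstar_algebra_1)"
  using star_scaleC[of 0 "0::'a"] by simp

lemma star_sum: "star (sum f A) = (\<Sum>i\<in>A. star (f i :: 'a::cstar_algebra_1))"
  by (induction A rule: infinite_finite_induct) (auto simp: star_add)

lemma continuous_on_scaleC:
  fixes f :: "'b::topological_space \<Rightarrow> 'a::cstar_algebra_1"
  assumes "continuous_on S f"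
  shows "continuous_on S (\<lambda>x. c *\<^sub>C f x)"
proof -
  \<comment> \<open>Scaling by \<open>c\<close> is multiplication by \<open>c *\<^sub>C 1\<close>,
    so continuity of the product applies.\<close>
  have "c *\<^sub>C f x = (c *\<^sub>C 1) * f x" for x by (simp add: mult_scaleC_left)
  then show ?thesis using assms by (auto intro: continuous_intros)
qed

lemma eval_cfun_simps [simp]:
  "eval_cfun 0 i = 0" "eval_cfun 1 i = 1" "eval_cfun (f + g) i = eval_cfun f i + eval_cfun g i"
  "eval_cfun (f * g) i = eval_cfun f i * eval_cfun g i"
  "eval_cfun (c *\<^sub>C f) i = c * eval_cfun f i"
  "eval_cfun (star f) i = cnj (eval_cfun f i)"
  "eval_cfun (char_cfun j) i = (if i = j then 1 else 0)"
  by (simp_all add: zero_cfun.rep_eq one_cfun.rep_eq plus_cfun.rep_eq times_cfun.rep_eq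
      scaleC_cfun.rep_eq star_cfun.rep_eq char_cfun_def Cfun_inverse)

lemma eval_cfun_sum [simp]: "eval_cfun (sum f A) i = (\<Sum>a\<in>A. eval_cfun (f a) i)"
  by (induction A rule: infinite_finite_induct) auto

lemma char_cfun_expansion: "f = (\<Sum>j\<in>UNIV. eval_cfun f j *\<^sub>C char_cfun j)"
  by (rule cfun_eqI) (simp add: if_distrib cong: if_cong)

lemma sum_char_cfun: "(\<Sum>j\<in>UNIV. char_cfun j) = 1"
  by (rule cfun_eqI) simp

lemma char_cfun_mult: "char_cfun j * char_cfun k = (if j = k then char_cfun j else 0)"
  by (rule cfun_eqI) simp

lemma star_char_cfun [simp]: "star (char_cfun j) = char_cfun j"
  by (rule cfun_eqI) simp

lemma char_cfun_nonzero [simp]: "char_cfun j \<noteq> 0"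
  using eval_cfun_simps(7)[of j j] by (auto simp del: eval_cfun_simps(7))

text \<open>Identifies algebra-valued functions on the finite space with tensors. With
  \<open>tens\<close> as a parameter it serves both B \<otimes> A and B \<otimes> (A \<otimes>
  A).\<close>

definition cfun_embed ::
  "('x::finite cfun \<Rightarrow> 'a::cstar_algebra_1 \<Rightarrow> 't::cstar_algebra_1) \<Rightarrow> ('x \<Rightarrow> 'a) \<Rightarrow> 't" where
  "cfun_embed tens f = (\<Sum>i\<in>UNIV. tens (char_cfun i) (f i))"

context min_tensor
begin

lemmas tens_simps =
  clinear_add[OF tens_linear_left] clinear_add[OF tens_linear_right]
  clinear_scale[OF tens_linear_left] clinear_scale[OF tens_linear_right]
  clinear_zero[OF tens_linear_left] clinear_zero[OF tens_linear_right]
  clinear_diff[OF tens_linear_left] clinear_diff[OF tens_linear_right]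

lemmas tens_sum_left = clinear_sum[OF tens_linear_left]
lemmas tens_sum_right = clinear_sum[OF tens_linear_right]

lemma tens_eq_0_imp:
  assumes "tens a b = 0" "a \<noteq> 0"
  shows "b = 0"
proof (rule ccontr)
  assume "b \<noteq> 0"
  then show False
    using tens_inj[of "{b}" "\<lambda>_. a" b] assms by (simp add: complex_space.dependent_single)
qed

end

section \<open>Tensors over a finite space as A-valued functions\<close>

locale cfun_tensor = min_tensor tens
  for tens :: "'x::finite cfun \<Rightarrow> 'a::cstar_algebra_1 \<Rightarrow> 't::cstar_algebra_1"
begin

abbreviation embed :: "('x \<Rightarrow> 'a) \<Rightarrow> 't" where
  "embed \<equiv> cfun_embed tens"

lemma tens_eq_embed: "tens b c = embed (\<lambda>i. eval_cfun b i *\<^sub>C c)"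
  unfolding cfun_embed_def
  by (subst char_cfun_expansion[of b]) (simp add: tens_sum_left tens_simps)

lemma embed_add: "embed f + embed g = embed (\<lambda>i. f i + g i)"
  by (simp add: cfun_embed_def tens_simps sum.distrib)

lemma embed_scaleC: "c *\<^sub>C embed f = embed (\<lambda>i. c *\<^sub>C f i)"
  by (simp add: cfun_embed_def tens_simps complex_space.scale_sum_right)

lemma embed_zero: "embed (\<lambda>i. 0) = 0"
  by (simp add: cfun_embed_def tens_simps)

lemma embed_mult: "embed f * embed g = embed (\<lambda>i. f i * g i)"
  by (simp add: cfun_embed_def sum_product tens_mult char_cfun_mult tens_simps
      if_distrib[of "\<lambda>x. tens x _"] cong: if_cong)

lemma star_embed: "star (embed f) = embed (\<lambda>i. star (f i))"
  by (simp add: cfun_embed_def star_sum tens_star)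

text \<open>Multiplication by \<open>tens (char_cfun i) 1\<close> isolates the \<open>i\<close>-th
  summand, and \<open>char_cfun i\<close> is nonzero.\<close>

lemma embed_eq_0_imp:
  assumes "embed f = 0"
  shows "f i = 0"
proof -
  have "tens (char_cfun i) (f i) = tens (char_cfun i) 1 * embed f"
    by (simp add: cfun_embed_def sum_distrib_left tens_mult char_cfun_mult tens_simps
        if_distrib[of "\<lambda>x. tens x _"] cong: if_cong)
  then show ?thesis using assms tens_eq_0_imp[of "char_cfun i" "f i"] by simp
qed

lemma embed_eq_iff: "embed f = embed g \<longleftrightarrow> f = g"
proof
  assume eq: "embed f = embed g"
  have "embed (\<lambda>i. f i - g i) = 0"
    using eq by (simp add: cfun_embed_def tens_simps sum_subtractf)
  from embed_eq_0_imp[OF this] show "f = g" by (simp add: fun_eq_iff)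
qed simp

text \<open>Turns density and minimality of the tensor product into statements about
  \<open>range embed\<close>.\<close>

lemma cspan_eq_range_embed: "cspan {tens a b |a b. True} = range embed"
proof (rule antisym)
  show "cspan {tens a b |a b. True} \<subseteq> range embed"
  proof (rule complex_space.span_minimal)
    show "{tens a b |a b. True} \<subseteq> range embed"
      using tens_eq_embed by auto
    show "complex_space.subspace (range embed)"
      unfolding complex_space.subspace_def
      by (auto simp: embed_add embed_scaleC intro: range_eqI[of _ _ "\<lambda>_. 0"] simp: embed_zero)
  qed
  show "range embed \<subseteq> cspan {tens a b |a b. True}"
    unfolding cfun_embed_def by (auto intro!: complex_space.span_sum intro: complex_space.span_base)
qed

text \<open>Inverse of \<open>embed\<close> on its range, where alone its value is specified; this
  suffices to define the norm to which \<open>tens_minimal\<close> is applied.\<close>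

definition coord :: "'t \<Rightarrow> 'x \<Rightarrow> 'a" where
  "coord x = (THE f. x = embed f)"

lemma coord_embed [simp]: "coord (embed f) = f"
  unfolding coord_def by (rule the_equality) (simp_all add: embed_eq_iff)

text \<open>The maximum of the coordinate norms is a C*-norm, so minimality of the tensor norm bounds
  the latter.\<close>

lemma norm_embed_le: "norm (embed f) \<le> (MAX i. norm (f i))"
proof -
  define N where "N x = (MAX i. norm (coord x i))" for x
  have le: "norm (f i) \<le> N (embed f)" for f i
    by (simp add: N_def)
  have least: "N (embed f) \<le> b" if "\<And>i. norm (f i) \<le> b" for f b
    using that by (simp add: N_def)
  have attained: "\<exists>i. N (embed f) = norm (f i)" for f
  proof -
    have "N (embed f) \<in> range (\<lambda>i. norm (f i))"
      unfolding N_def coord_embed by (rule Max_in) auto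
    then show ?thesis by blast
  qed
  have nonneg: "0 \<le> N (embed f)" for f
    using attained[of f] by auto
  have "cstar_norm_on (range embed) N"
    unfolding cstar_norm_on_def
  proof (intro conjI ballI allI)
    fix x y :: 't and c
    assume "x \<in> range embed" "y \<in> range embed"
    then obtain f g where xy: "x = embed f" "y = embed g" by auto
    show "N (x + y) \<le> N x + N y"
      unfolding xy embed_add by (intro least norm_triangle_le add_mono le)
    show "N (x * y) \<le> N x * N y"
      unfolding xy embed_mult
      by (intro least order_trans[OF norm_mult_ineq] mult_mono le nonneg norm_ge_zero)
  next
    fix x :: 't and c
    assume "x \<in> range embed"
    then obtain f where x: "x = embed f" by auto
    show "0 \<le> N x" by (simp add: x nonneg)
    show "N x = 0 \<longleftrightarrow> x = 0"
    proof
      assume "N x = 0"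
      then have "f = (\<lambda>_. 0)" using le[of f] by (auto simp: x)
      then show "x = 0" by (simp add: x embed_zero)
    next
      assume "x = 0"
      then have "f = (\<lambda>_. 0)" using embed_eq_0_imp by (auto simp: x)
      then show "N x = 0" by (simp add: x N_def)
    qed
    have starx: "star (embed f) * embed f = embed (\<lambda>i. star (f i) * f i)"
      by (simp add: star_embed embed_mult)
    show "N (star x * x) = (N x)\<^sup>2"
    proof (rule antisym)
      show "N (star x * x) \<le> (N x)\<^sup>2"
        unfolding x starx by (intro least) (simp add: cstar_identity power_mono le)
      \<comment> \<open>A coordinate attaining the maximum reduces the reverse inequality to the
        C*-identity in A.\<close>
      obtain i where "N x = norm (f i)" using attained x by auto
      then show "(N x)\<^sup>2 \<le> N (star x * x)"
        using le[of "\<lambda>i. star (f i) * f i" i] by (simp add: x starx cstar_identity)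
    qed
    show "N (c *\<^sub>C x) = cmod c * N x"
    proof (rule antisym)
      show "N (c *\<^sub>C x) \<le> cmod c * N x"
        unfolding x embed_scaleC by (intro least) (simp add: norm_scaleC mult_left_mono le)
      obtain i where "N x = norm (f i)" using attained x by auto
      then show "cmod c * N x \<le> N (c *\<^sub>C x)"
        using le[of "\<lambda>i. c *\<^sub>C f i" i] by (simp add: x embed_scaleC norm_scaleC)
    qed
  qed
  then have "norm (embed f) \<le> N (embed f)"
    by (rule tens_minimal[unfolded cspan_eq_range_embed, OF _ rangeI])
  then show ?thesis by (simp add: N_def)
qed

text \<open>By \<open>norm_embed_le\<close>, applied to functions supported at one point,
  \<open>tens (char_cfun i)\<close> is a contraction; a general \<open>b\<close> is a finite
  combination of indicators.\<close>

lemma continuous_on_tens_right: "continuous_on UNIV (\<lambda>c. tens b c)"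
proof -
  have "continuous_on UNIV (\<lambda>c. tens (char_cfun i) c)" for i
  proof (rule continuous_onI)
    fix c :: 'a and e :: real
    assume "0 < e"
    have "norm (tens (char_cfun i) d) \<le> norm d" for d
    proof -
      have "embed (\<lambda>j. if j = i then d else 0)
          = (\<Sum>j\<in>UNIV. if j = i then tens (char_cfun i) d else 0)"
        unfolding cfun_embed_def by (intro sum.cong) (auto simp: tens_simps)
      then have "norm (tens (char_cfun i) d) \<le> (MAX j. norm (if j = i then d else 0))"
        using norm_embed_le[of "\<lambda>j. if j = i then d else 0"] by simp
      also have "\<dots> \<le> norm d"
        by simp
      finally show ?thesis .
    qed
    from this[of "_ - c"] have "dist (tens (char_cfun i) d) (tens (char_cfun i) c) \<le> dist d c" for d
      by (simp add: dist_norm tens_simps)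
    then show "\<exists>\<delta>>0. \<forall>d\<in>UNIV. dist d c < \<delta> \<longrightarrow>
        dist (tens (char_cfun i) d) (tens (char_cfun i) c) \<le> e"
      using \<open>0 < e\<close> by (metis less_imp_le order_trans)
  qed
  then have "continuous_on UNIV (\<lambda>c. \<Sum>i\<in>UNIV. eval_cfun b i *\<^sub>C tens (char_cfun i) c)"
    by (intro continuous_intros continuous_on_scaleC)
  then show ?thesis
    by (simp add: tens_eq_embed[of b] cfun_embed_def tens_simps)
qed

end

section \<open>Slice maps as coordinates on the whole tensor product\<close>

locale cfun_tensor_slices = cfun_tensor tens
  for tens :: "'x::finite cfun \<Rightarrow> 'a::cstar_algebra_1 \<Rightarrow> 't::cstar_algebra_1" +
  fixes slice :: "'x \<Rightarrow> 't \<Rightarrow> 'a"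
  assumes slice_tensor_map: "tensor_map tens tens_C_left (ev i) id (slice i)"
begin

lemma clinear_slice: "clinear (slice i)"
  and continuous_on_slice: "continuous_on S (slice i)"
  and slice_tens: "slice i (tens b c) = eval_cfun b i *\<^sub>C c"
  using slice_tensor_map[of i] continuous_on_subset[of UNIV "slice i" S]
  by (simp_all add: tensor_map_def tens_C_left_def)

lemma slice_embed [simp]: "slice i (embed f) = f i"
proof -
  have "slice i (embed f) = (\<Sum>k\<in>UNIV. if k = i then f i else 0)"
    unfolding cfun_embed_def clinear_sum[OF clinear_slice] by (intro sum.cong) (auto simp: slice_tens)
  then show ?thesis by simp
qed

text \<open>Both sides are continuous and agree on the dense set \<open>range embed\<close>. Hence
  the algebraic tensor product is already everything.\<close>

lemma embed_slice: "embed (\<lambda>i. slice i x) = x"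
proof -
  have cont: "continuous_on UNIV (\<lambda>x. embed (\<lambda>i. slice i x))"
    unfolding cfun_embed_def
    by (intro continuous_on_sum continuous_on_compose2[OF continuous_on_tens_right] continuous_on_slice)
      auto
  have "closed {x. embed (\<lambda>i. slice i x) = x}"
    by (intro closed_Collect_eq cont continuous_on_id)
  moreover have "range embed \<subseteq> {x. embed (\<lambda>i. slice i x) = x}"
    by auto
  ultimately have "closure (range embed) \<subseteq> {x. embed (\<lambda>i. slice i x) = x}"
    by (rule closure_minimal[rotated])
  then show ?thesis
    using tens_dense[unfolded cspan_eq_range_embed] by auto
qed

lemma slice_eqI:
  assumes "\<And>i. slice i x = slice i y"
  shows "x = y"
  using embed_slice[of x] unfolding assms embed_slice by (rule sym)

lemma slice_mult: "slice i (x * y) = slice i x * slice i y"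
  by (subst embed_slice[of x, symmetric], subst embed_slice[of y, symmetric]) (simp add: embed_mult)

lemma slice_star: "slice i (star x) = star (slice i x)"
  by (subst embed_slice[of x, symmetric]) (simp add: star_embed)

lemma slice_one: "slice i 1 = 1"
  using slice_tens[of i 1 1] by (simp add: tens_one)

lemma tensor_map_functional:
  assumes "tensor_map tens tens_C_left \<psi> id F"
  shows "F x = (\<Sum>i\<in>UNIV. \<psi> (char_cfun i) *\<^sub>C slice i x)"
proof -
  have "F x = F (embed (\<lambda>i. slice i x))" by (simp add: embed_slice)
  also have "\<dots> = (\<Sum>i\<in>UNIV. \<psi> (char_cfun i) *\<^sub>C slice i x)"
    using assms unfolding tensor_map_def cfun_embed_def by (simp add: clinear_sum tens_C_left_def)
  finally show ?thesis .
qed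

text \<open>Supplies the map \<psi> \<otimes> id whose existence \<open>invariant_state\<close>
  demands.\<close>

lemma tensor_map_functional_exists:
  assumes "clinear \<psi>"
  shows "tensor_map tens tens_C_left \<psi> id (\<lambda>x. \<Sum>i\<in>UNIV. \<psi> (char_cfun i) *\<^sub>C slice i x)"
proof -
  have psi: "\<psi> b = (\<Sum>i\<in>UNIV. \<psi> (char_cfun i) * eval_cfun b i)" for b
    by (subst char_cfun_expansion[of b])
      (simp add: clinear_sum[OF assms] clinear_scale[OF assms] scaleC_complex_def mult.commute)
  show ?thesis
    unfolding tensor_map_def
  proof (intro conjI allI)
    show "clinear (\<lambda>x. \<Sum>i\<in>UNIV. \<psi> (char_cfun i) *\<^sub>C slice i x)"
      by (simp add: clinear_iff clinear_add[OF clinear_slice] clinear_scale[OF clinear_slice]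
          scaleC_add_right sum.distrib complex_space.scale_sum_right scaleC_scaleC mult.commute)
    show "continuous_on UNIV (\<lambda>x. \<Sum>i\<in>UNIV. \<psi> (char_cfun i) *\<^sub>C slice i x)"
      by (intro continuous_on_sum continuous_on_scaleC continuous_on_slice)
    show "(\<Sum>i\<in>UNIV. \<psi> (char_cfun i) *\<^sub>C slice i (tens b c)) = tens_C_left (\<psi> b) (id c)" for b c
      by (subst psi[of b])
        (simp add: slice_tens scaleC_scaleC tens_C_left_def complex_space.scale_sum_left)
  qed
qed

end


section \<open>The matrix of an action\<close>

text \<open>Collects the facts on the action and the Haar measure from which the equivalence
  follows. With \<open>P = (h (a i j))\<close>, \<open>h_left\<close> reads \<open>P a = P\<close>
  and \<open>h_right\<close> reads \<open>a P = P\<close>.\<close>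

locale action_matrix =
  fixes a :: "'x::finite \<Rightarrow> 'x \<Rightarrow> 'a::cstar_algebra_1"
    and h :: "'a \<Rightarrow> complex"
  assumes row_orth: "\<And>i j k. a i j * a i k = (if j = k then a i j else 0)"
    and row_sum: "\<And>i. (\<Sum>j\<in>UNIV. a i j) = 1"
    and right_inverse: "\<And>i. \<exists>w. \<forall>k. (\<lambda>n. \<Sum>j\<in>UNIV. a k j * w n j)
      \<longlonglongrightarrow> (if k = i then 1 else 0)"
    and clinear_h: "clinear h"
    and h_one: "h 1 = 1"
    and h_nonneg: "\<And>i j. h (a i j) \<in> \<real>\<^sub>\<ge>\<^sub>0"
    and h_left: "\<And>i j. (\<Sum>k\<in>UNIV. h (a i k) *\<^sub>C a k j) = h (a i j) *\<^sub>C 1"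
    and h_right: "\<And>i j. (\<Sum>k\<in>UNIV. h (a k j) *\<^sub>C a i k) = h (a i j) *\<^sub>C 1"
begin

lemma h_row_sum: "(\<Sum>j\<in>UNIV. h (a i j)) = 1"
  by (simp add: clinear_sum[OF clinear_h, symmetric] row_sum h_one)

lemma column_sum: "(\<Sum>i\<in>UNIV. a i j) = 1"
proof -
  \<comment> \<open>The values of \<open>h\<close> here are nonnegative reals; real parts give the
    real weights that \<open>column_sum_eq_1\<close> takes.\<close>
  define p where "p i j = Re (h (a i j))" for i j
  define \<psi> where "\<psi> j = (\<Sum>i\<in>UNIV. p i j)" for j
  have h_eq: "h (a i j) = complex_of_real (p i j)" and p_nonneg: "0 \<le> p i j" for i j
    using h_nonneg[of i j] by (auto simp: p_def complex_nonneg_Reals_iff complex_eq_iff)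
  have left: "(\<Sum>k\<in>UNIV. p i k *\<^sub>R a k j) = p i j *\<^sub>R 1" for i j
    using h_left[where i = i and j = j] by (simp add: h_eq scaleC_of_real)
  have inv: "(\<Sum>i\<in>UNIV. \<psi> i *\<^sub>R a i j) = \<psi> j *\<^sub>R 1" for j
  proof -
    have "(\<Sum>i\<in>UNIV. \<psi> i *\<^sub>R a i j) = (\<Sum>i\<in>UNIV. \<Sum>k\<in>UNIV. p k i *\<^sub>R a i j)"
      by (simp add: \<psi>_def scaleR_sum_left)
    also have "\<dots> = (\<Sum>k\<in>UNIV. \<Sum>i\<in>UNIV. p k i *\<^sub>R a i j)"
      by (rule sum.swap)
    finally show ?thesis by (simp add: left \<psi>_def scaleR_sum_left)
  qed
  have "\<psi> i \<noteq> 0" for i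
  proof
    assume "\<psi> i = 0"
    \<comment> \<open>A sum of nonnegative entries vanishes only if each entry does.\<close>
    have "p i j = 0" if "\<psi> j = 0" for j
      using that p_nonneg by (simp add: \<psi>_def sum_nonneg_eq_0_iff)
    then have "h (\<Sum>j | \<psi> j = 0. a i j) = 0"
      by (simp add: clinear_sum[OF clinear_h] h_eq)
    moreover have "(\<Sum>j | \<psi> j = 0. a i j) = 1"
      by (rule sum_null_columns[OF row_orth inv right_inverse \<open>\<psi> i = 0\<close>])
    ultimately show False by (simp add: h_one)
  qed
  then show ?thesis by (rule column_sum_eq_1[OF row_orth inv right_inverse])
qed

text \<open>Right multiplication of the \<open>i\<close>-th equation by \<open>a i j\<close> leaves
  \<open>b j *\<^sub>C a i j = b i *\<^sub>C a i j\<close> by row orthogonality.\<close>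

lemma fixed_vector_const_if_nonzero:
  assumes nonzero: "\<And>i j. a i j \<noteq> 0"
    and fixed: "\<And>i. (\<Sum>j\<in>UNIV. b j *\<^sub>C a i j) = b i *\<^sub>C 1"
  shows "b i = b j"
proof -
  have "b i *\<^sub>C a i j = (\<Sum>k\<in>UNIV. b k *\<^sub>C a i k) * a i j"
    by (simp add: fixed mult_scaleC_left)
  also have "\<dots> = (\<Sum>k\<in>UNIV. if k = j then b j *\<^sub>C a i j else 0)"
    unfolding sum_distrib_right by (intro sum.cong) (auto simp: mult_scaleC_left row_orth)
  finally show ?thesis
    using nonzero[of i j] by (simp add: complex_space.scale_right_imp_eq)
qed

text \<open>By \<open>h_right\<close> each column of \<open>P\<close> is a fixed vector, hence
  constant; by \<open>column_sum\<close> its entries add up to 1.\<close>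

lemma h_uniform_if_fixed_vectors_const:
  assumes const: "\<And>b i j. (\<And>i. (\<Sum>j\<in>UNIV. b j *\<^sub>C a i j) = b i *\<^sub>C 1) \<Longrightarrow> b i = b j"
  shows "h (a i j) = 1 / of_nat CARD('x)"
proof -
  have "1 = (\<Sum>k\<in>UNIV. h (a k j))"
    by (simp add: clinear_sum[OF clinear_h, symmetric] column_sum h_one)
  also have "\<dots> = (\<Sum>k\<in>(UNIV::'x set). h (a i j))"
    by (intro sum.cong refl const[of "\<lambda>i. h (a i j)"] h_right)
  finally show ?thesis by (simp add: field_simps)
qed

lemma nonzero_if_h_uniform:
  assumes "h (a i j) = 1 / of_nat CARD('x)"
  shows "a i j \<noteq> 0"
  using assms clinear_zero[OF clinear_h] by auto

text \<open>Apply \<open>h\<close> to the invariance relation.\<close>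

lemma invariant_uniform_if_h_uniform:
  assumes uniform: "\<And>i j. h (a i j) = 1 / of_nat CARD('x)"
    and "(\<Sum>i\<in>UNIV. t i) = 1"
    and inv: "(\<Sum>i\<in>UNIV. t i *\<^sub>C a i j) = t j *\<^sub>C 1"
  shows "t j = 1 / of_nat CARD('x)"
proof -
  have "t j = h (\<Sum>i\<in>UNIV. t i *\<^sub>C a i j)"
    by (simp add: inv clinear_scale[OF clinear_h] h_one scaleC_complex_def)
  also have "\<dots> = (\<Sum>i\<in>UNIV. t i) * (1 / of_nat CARD('x))"
    by (simp add: clinear_sum[OF clinear_h] clinear_scale[OF clinear_h] uniform scaleC_complex_def
        sum_divide_distrib)
  finally show ?thesis using assms(2) by simp
qed

end

section \<open>Coefficients of an action on a finite space\<close>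

context cfun_tensor_slices
begin

context
  fixes \<alpha> :: "'x cfun \<Rightarrow> 't" and a :: "'x \<Rightarrow> 'x \<Rightarrow> 'a"
  assumes \<alpha>_hom: "unital_star_hom \<alpha>"
    and a_eq: "\<And>i j. a i j = slice i (\<alpha> (char_cfun j))"
begin

lemma clinear_\<alpha>: "clinear \<alpha>"
  and \<alpha>_mult: "\<alpha> (b * c) = \<alpha> b * \<alpha> c"
  and \<alpha>_star: "\<alpha> (star b) = star (\<alpha> b)"
  and \<alpha>_one: "\<alpha> 1 = 1"
  using \<alpha>_hom by (auto simp: unital_star_hom_def)

lemma \<alpha>_char_cfun: "\<alpha> (char_cfun j) = embed (\<lambda>i. a i j)"
  by (simp add: a_eq embed_slice)

lemma slice_\<alpha>: "slice i (\<alpha> b) = (\<Sum>j\<in>UNIV. eval_cfun b j *\<^sub>C a i j)"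
  by (subst char_cfun_expansion[of b])
    (simp add: a_eq clinear_sum[OF clinear_\<alpha>] clinear_scale[OF clinear_\<alpha>]
      clinear_sum[OF clinear_slice] clinear_scale[OF clinear_slice] del: eval_cfun_sum)

text \<open>For fixed \<open>i\<close>, the composition of \<alpha> with \<open>slice i\<close> is
  multiplicative, so the row inherits the orthogonality of the indicators.\<close>

lemma coefficient_orth: "a i j * a i k = (if j = k then a i j else 0)"
  by (simp add: a_eq slice_mult[symmetric] \<alpha>_mult[symmetric] char_cfun_mult
      clinear_zero[OF clinear_\<alpha>] clinear_zero[OF clinear_slice])

lemma star_coefficient: "star (a i j) = a i j"
  by (simp add: a_eq slice_star[symmetric] \<alpha>_star[symmetric])

lemma coefficient_row_sum: "(\<Sum>j\<in>UNIV. a i j) = 1"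
  by (simp add: a_eq clinear_sum[OF clinear_slice, symmetric] clinear_sum[OF clinear_\<alpha>, symmetric]
      sum_char_cfun \<alpha>_one slice_one)

text \<open>In coordinates, elements of the span are products of the matrix \<open>a\<close> with a
  column; density lets such products approximate each unit vector.\<close>

lemma coefficient_right_inverse:
  assumes dense: "closure (cspan {\<alpha> b * tens 1 c |c b. True}) = UNIV"
  shows "\<exists>w. \<forall>k. (\<lambda>n. \<Sum>j\<in>UNIV. a k j * w n j) \<longlonglongrightarrow> (if k = i then 1 else 0)"
proof -
  \<comment> \<open>The tensors whose coordinate column lies in the range of the matrix
    \<open>a\<close>, a subspace.\<close>
  define R where "R = {x. \<exists>c. \<forall>k. slice k x = (\<Sum>j\<in>UNIV. a k j * c j)}"
  have "{\<alpha> b * tens 1 c |c b. True} \<subseteq> R"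
  proof clarify
    fix b c
    have "slice k (\<alpha> b * tens 1 c) = (\<Sum>j\<in>UNIV. a k j * (eval_cfun b j *\<^sub>C c))" for k
      by (simp add: slice_mult slice_tens slice_\<alpha> sum_distrib_right mult_scaleC_left mult_scaleC_right)
    then show "\<alpha> b * tens 1 c \<in> R"
      unfolding R_def by (intro CollectI exI[of _ "\<lambda>j. eval_cfun b j *\<^sub>C c"] allI)
  qed
  moreover have "complex_space.subspace R"
    unfolding complex_space.subspace_def
  proof (intro conjI ballI allI)
    show "0 \<in> R"
      unfolding R_def by (auto simp: clinear_zero[OF clinear_slice] intro: exI[of _ "\<lambda>_. 0"])
  next
    fix x y assume "x \<in> R" "y \<in> R"
    then obtain c d where "\<And>k. slice k x = (\<Sum>j\<in>UNIV. a k j * c j)"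
      "\<And>k. slice k y = (\<Sum>j\<in>UNIV. a k j * d j)"
      unfolding R_def by auto
    then have "slice k (x + y) = (\<Sum>j\<in>UNIV. a k j * (c j + d j))" for k
      by (simp add: clinear_add[OF clinear_slice] distrib_left sum.distrib)
    then show "x + y \<in> R"
      unfolding R_def by (intro CollectI exI[of _ "\<lambda>j. c j + d j"] allI)
  next
    fix z x assume "x \<in> R"
    then obtain c where "\<And>k. slice k x = (\<Sum>j\<in>UNIV. a k j * c j)"
      unfolding R_def by auto
    then have "slice k (z *\<^sub>C x) = (\<Sum>j\<in>UNIV. a k j * (z *\<^sub>C c j))" for k
      by (simp add: clinear_scale[OF clinear_slice] mult_scaleC_right complex_space.scale_sum_right)
    then show "z *\<^sub>C x \<in> R"
      unfolding R_def by (intro CollectI exI[of _ "\<lambda>j. z *\<^sub>C c j"] allI)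
  qed
  ultimately have "cspan {\<alpha> b * tens 1 c |c b. True} \<subseteq> R"
    by (rule complex_space.span_minimal)
  then have "closure R = UNIV"
    using closure_mono dense by blast
  \<comment> \<open>The coordinates of this tensor form the \<open>i\<close>-th unit vector.\<close>
  then have "tens (char_cfun i) 1 \<in> closure R"
    by simp
  then obtain x where x: "\<And>n. x n \<in> R" "x \<longlonglongrightarrow> tens (char_cfun i) 1"
    unfolding closure_sequential by auto
  then have "\<forall>n. \<exists>c. \<forall>k. slice k (x n) = (\<Sum>j\<in>UNIV. a k j * c j)"
    unfolding R_def by simp
  then obtain w where w: "\<And>n k. slice k (x n) = (\<Sum>j\<in>UNIV. a k j * w n j)"
    by metis
  have "(\<lambda>n. slice k (x n)) \<longlonglongrightarrow> slice k (tens (char_cfun i) 1)" for k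
    using continuous_on_tendsto_compose[OF continuous_on_slice[of UNIV k] x(2)] by simp
  then have "(\<lambda>n. \<Sum>j\<in>UNIV. a k j * w n j) \<longlonglongrightarrow> (if k = i then 1 else 0)" for k
    by (simp add: w slice_tens if_distrib[of "\<lambda>c. c *\<^sub>C 1"] cong: if_cong)
  then show ?thesis by blast
qed

text \<open>Comparing slices turns the fixed-point equation into a linear system. Scalars always
  solve it, so only one inclusion is at stake.\<close>

lemma ergodic_iff_fixed_vectors_const:
  "ergodic tens \<alpha> \<longleftrightarrow>
    (\<forall>b. (\<forall>i. (\<Sum>j\<in>UNIV. b j *\<^sub>C a i j) = b i *\<^sub>C 1) \<longrightarrow> (\<forall>i j. b i = b j))"
proof -
  have fixed: "\<alpha> b = tens b 1 \<longleftrightarrow> (\<forall>i. (\<Sum>j\<in>UNIV. eval_cfun b j *\<^sub>C a i j) = eval_cfun b i *\<^sub>C 1)" for b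
  proof -
    have "\<alpha> b = tens b 1 \<longleftrightarrow> (\<forall>i. slice i (\<alpha> b) = slice i (tens b 1))"
      by (auto intro: slice_eqI)
    then show ?thesis by (simp only: slice_\<alpha> slice_tens)
  qed
  have const: "b \<in> {c *\<^sub>C 1 |c. True} \<longleftrightarrow> (\<forall>i j. eval_cfun b i = eval_cfun b j)" for b :: "'x cfun"
  proof
    assume "\<forall>i j. eval_cfun b i = eval_cfun b j"
    \<comment> \<open>Any point would do in place of \<open>undefined\<close>, since
      \<open>b\<close> is constant.\<close>
    then have "b = eval_cfun b undefined *\<^sub>C 1"
      by (intro cfun_eqI) simp
    then show "b \<in> {c *\<^sub>C 1 |c. True}" by blast
  qed auto
  have all_eval: "(\<forall>b. P (eval_cfun b)) \<longleftrightarrow> (\<forall>f. P f)" for P :: "('x \<Rightarrow> complex) \<Rightarrow> bool"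
    by (metis Cfun_inverse UNIV_I)
  have "\<alpha> (c *\<^sub>C 1) = tens (c *\<^sub>C 1) 1" for c
    by (simp add: clinear_scale[OF clinear_\<alpha>] \<alpha>_one tens_simps tens_one)
  then have "{c *\<^sub>C 1 |c. True} \<subseteq> {b. \<alpha> b = tens b 1}"
    by auto
  then have "ergodic tens \<alpha> \<longleftrightarrow> (\<forall>b. \<alpha> b = tens b 1 \<longrightarrow> b \<in> {c *\<^sub>C 1 |c. True})"
    unfolding ergodic_def by blast
  also have "\<dots> \<longleftrightarrow> (\<forall>b. (\<forall>i. (\<Sum>j\<in>UNIV. b j *\<^sub>C a i j) = b i *\<^sub>C 1) \<longrightarrow> (\<forall>i j. b i = b j))"
    unfolding fixed const
    by (rule all_eval[of "\<lambda>b. (\<forall>i. (\<Sum>j\<in>UNIV. b j *\<^sub>C a i j) = b i *\<^sub>C 1) \<longrightarrow> (\<forall>i j. b i = b j)"])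
  finally show ?thesis .
qed

text \<open>The map \<psi> \<otimes> id must be the weighted sum of slices, and by linearity
  invariance need only be tested on indicators.\<close>

lemma invariant_state_iff:
  "invariant_state tens \<alpha> \<psi> \<longleftrightarrow> state \<psi> \<and>
    (\<forall>j. (\<Sum>i\<in>UNIV. \<psi> (char_cfun i) *\<^sub>C a i j) = \<psi> (char_cfun j) *\<^sub>C 1)"
proof (intro iffI conjI allI; (elim conjE)?)
  assume "invariant_state tens \<alpha> \<psi>"
  then obtain F where F: "tensor_map tens tens_C_left \<psi> id F" "\<And>b. F (\<alpha> b) = \<psi> b *\<^sub>C 1"
    and "state \<psi>"
    unfolding invariant_state_def by auto
  then show "state \<psi>" by simp
  show "(\<Sum>i\<in>UNIV. \<psi> (char_cfun i) *\<^sub>C a i j) = \<psi> (char_cfun j) *\<^sub>C 1" for j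
    using F(2)[of "char_cfun j"] by (simp add: tensor_map_functional[OF F(1)] a_eq)
next
  assume "state \<psi>"
    and inv: "\<forall>j. (\<Sum>i\<in>UNIV. \<psi> (char_cfun i) *\<^sub>C a i j) = \<psi> (char_cfun j) *\<^sub>C 1"
  then have lin: "clinear \<psi>" by (simp add: state_def)
  have "(\<Sum>i\<in>UNIV. \<psi> (char_cfun i) *\<^sub>C slice i (\<alpha> b)) = \<psi> b *\<^sub>C 1" for b
  proof -
    have "(\<Sum>i\<in>UNIV. \<psi> (char_cfun i) *\<^sub>C slice i (\<alpha> b))
        = (\<Sum>i\<in>UNIV. \<Sum>j\<in>UNIV. eval_cfun b j *\<^sub>C \<psi> (char_cfun i) *\<^sub>C a i j)"
      by (simp add: slice_\<alpha> complex_space.scale_sum_right scaleC_scaleC mult.commute)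
    also have "\<dots> = (\<Sum>j\<in>UNIV. eval_cfun b j *\<^sub>C (\<Sum>i\<in>UNIV. \<psi> (char_cfun i) *\<^sub>C a i j))"
      unfolding complex_space.scale_sum_right by (rule sum.swap)
    also have "\<dots> = (\<Sum>j\<in>UNIV. eval_cfun b j * \<psi> (char_cfun j)) *\<^sub>C 1"
      by (simp add: inv scaleC_scaleC complex_space.scale_sum_left)
    also have "(\<Sum>j\<in>UNIV. eval_cfun b j * \<psi> (char_cfun j)) = \<psi> b"
      by (subst (2) char_cfun_expansion[of b])
        (simp add: clinear_sum[OF lin] clinear_scale[OF lin] scaleC_complex_def del: eval_cfun_sum)
    finally show ?thesis .
  qed
  then show "invariant_state tens \<alpha> \<psi>"
    unfolding invariant_state_def
    using \<open>state \<psi>\<close> tensor_map_functional_exists[OF lin] by blast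
qed

text \<open>Evaluate both sides of the coaction identity at \<open>char_cfun j\<close> and compare
  coordinates in B \<otimes> (A \<otimes> A).\<close>

lemma comult_coefficient:
  assumes action: "cqg_action tens' \<Delta> tens tensL tensR \<alpha>"
  shows "\<Delta> (a i j) = (\<Sum>k\<in>UNIV. tens' (a i k) (a k j))"
proof -
  have triple: "triple_tensor tens tens' tensL tensR"
    using action by (simp add: cqg_action_def)
  interpret L: min_tensor tensL
    using triple by (simp add: triple_tensor_def)
  \<comment> \<open>The right bracketing is again a tensor product with functions on the space, so
    coordinates are unique there too.\<close>
  interpret R: cfun_tensor tensR
    using triple by (simp add: triple_tensor_def cfun_tensor_def)
  have LR: "tensL (tens b c) d = tensR b (tens' c d)" for b c d
    using triple by (simp add: triple_tensor_def)
  obtain F G where F: "tensor_map tens tensL \<alpha> id F" and G: "tensor_map tens tensR id \<Delta> G"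
    and FG: "\<And>b. F (\<alpha> b) = G (\<alpha> b)"
    using action by (auto simp: cqg_action_def)
  have "F (\<alpha> (char_cfun j)) = (\<Sum>k\<in>UNIV. tensL (\<alpha> (char_cfun k)) (a k j))"
    using F unfolding \<alpha>_char_cfun[of j] cfun_embed_def by (simp add: tensor_map_def clinear_sum)
  also have "\<dots> = (\<Sum>k\<in>UNIV. \<Sum>i\<in>UNIV. tensR (char_cfun i) (tens' (a i k) (a k j)))"
    unfolding \<alpha>_char_cfun cfun_embed_def by (simp add: L.tens_sum_left LR)
  also have "\<dots> = R.embed (\<lambda>i. \<Sum>k\<in>UNIV. tens' (a i k) (a k j))"
    unfolding cfun_embed_def by (subst sum.swap) (simp add: R.tens_sum_right)
  finally have "R.embed (\<lambda>i. \<Sum>k\<in>UNIV. tens' (a i k) (a k j)) = G (\<alpha> (char_cfun j))"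
    by (simp add: FG)
  also have "\<dots> = R.embed (\<lambda>i. \<Delta> (a i j))"
    using G unfolding \<alpha>_char_cfun[of j] cfun_embed_def by (simp add: tensor_map_def clinear_sum)
  finally show ?thesis
    by (simp add: R.embed_eq_iff fun_eq_iff)
qed

text \<open>Invariance of \<open>h\<close> is applied to the formula for
  \<open>\<Delta> (a i j)\<close>; positivity holds because each coefficient is a
  projection.\<close>

lemma action_matrix:
  assumes action: "cqg_action tens' \<Delta> tens tensL tensR \<alpha>"
    and haar: "haar_measure tens' \<Delta> h"
  shows "action_matrix a h"
proof (rule action_matrix.intro)
  obtain F G where F: "tensor_map tens' tens_C_left h id F" and G: "tensor_map tens' tens_C_right id h G"
    and FG: "\<And>x. F (\<Delta> x) = h x *\<^sub>C 1" "\<And>x. G (\<Delta> x) = h x *\<^sub>C 1"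
    and "state h"
    using haar by (auto simp: haar_measure_def)
  then show "clinear h" "h 1 = 1"
    by (auto simp: state_def)
  show "h (a i j) \<in> \<real>\<^sub>\<ge>\<^sub>0" for i j
  proof -
    have "h (star (a i j) * a i j) \<in> \<real>\<^sub>\<ge>\<^sub>0"
      using \<open>state h\<close> unfolding state_def by blast
    then show ?thesis by (simp add: star_coefficient coefficient_orth)
  qed
  show "(\<Sum>k\<in>UNIV. h (a i k) *\<^sub>C a k j) = h (a i j) *\<^sub>C 1" for i j
    using FG(1)[of "a i j"] F unfolding comult_coefficient[OF action]
    by (simp add: tensor_map_def clinear_sum tens_C_left_def)
  show "(\<Sum>k\<in>UNIV. h (a k j) *\<^sub>C a i k) = h (a i j) *\<^sub>C 1" for i j
    using FG(2)[of "a i j"] G unfolding comult_coefficient[OF action]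
    by (simp add: tensor_map_def clinear_sum tens_C_right_def)
  show "\<exists>w. \<forall>k. (\<lambda>n. \<Sum>j\<in>UNIV. a k j * w n j) \<longlonglongrightarrow> (if k = i then 1 else 0)" for i
    using action by (intro coefficient_right_inverse) (simp add: cqg_action_def)
qed (simp_all add: coefficient_orth coefficient_row_sum)

end

end

section \<open>States on a finite space and the equivalence\<close>

lemma state_char_cfun_sum:
  assumes "state \<psi>"
  shows "(\<Sum>i\<in>UNIV. \<psi> (char_cfun i)) = 1"
  using assms by (simp add: state_def clinear_sum[symmetric] sum_char_cfun)

lemma nonneg_Reals_sum:
  fixes f :: "'i \<Rightarrow> complex"
  assumes "\<And>i. i \<in> A \<Longrightarrow> f i \<in> \<real>\<^sub>\<ge>\<^sub>0"
  shows "sum f A \<in> \<real>\<^sub>\<ge>\<^sub>0"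
  using assms by (simp add: complex_nonneg_Reals_iff sum_nonneg)

text \<open>Used to make states of the rows of \<open>P\<close>, which are probability
  vectors.\<close>

lemma state_weighted_sum:
  fixes t :: "'x::finite \<Rightarrow> complex"
  assumes "\<And>i. t i \<in> \<real>\<^sub>\<ge>\<^sub>0" "(\<Sum>i\<in>UNIV. t i) = 1"
  shows "state (\<lambda>b. \<Sum>i\<in>UNIV. t i * eval_cfun b i)"
  unfolding state_def
proof (intro conjI allI)
  show "clinear (\<lambda>b. \<Sum>i\<in>UNIV. t i * eval_cfun b i)"
    unfolding clinear_iff
    by (simp add: scaleC_complex_def distrib_left sum.distrib sum_distrib_left
        mult.left_commute)
  have "t i * (cnj z * z) \<in> \<real>\<^sub>\<ge>\<^sub>0" for i z
  proof -
    have "cnj z * z \<in> \<real>\<^sub>\<ge>\<^sub>0"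
      by (simp add: complex_nonneg_Reals_iff)
    with assms(1) show ?thesis by (rule nonneg_Reals_mult_I)
  qed
  then show "(\<Sum>i\<in>UNIV. t i * eval_cfun (star b * b) i) \<in> \<real>\<^sub>\<ge>\<^sub>0" for b
    by (simp add: nonneg_Reals_sum)
qed (use assms(2) in simp)

theorem theorem4p22:
  fixes tens :: "'a::cstar_algebra_1 \<Rightarrow> 'a \<Rightarrow> 'aa::cstar_algebra_1"
    and tensL :: "'aa \<Rightarrow> 'a \<Rightarrow> 'aaa::cstar_algebra_1"
    and tensR :: "'a \<Rightarrow> 'aa \<Rightarrow> 'aaa"
    and \<Delta> :: "'a \<Rightarrow> 'aa"
    and h :: "'a \<Rightarrow> complex"
    and tensB :: "'x::finite cfun \<Rightarrow> 'a \<Rightarrow> 'ba::cstar_algebra_1"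
    and tensBL :: "'ba \<Rightarrow> 'a \<Rightarrow> 'baa::cstar_algebra_1"
    and tensBR :: "'x cfun \<Rightarrow> 'aa \<Rightarrow> 'baa"
    and \<alpha> :: "'x cfun \<Rightarrow> 'ba"
    and ev_id :: "'x \<Rightarrow> 'ba \<Rightarrow> 'a"
    and a :: "'x \<Rightarrow> 'x \<Rightarrow> 'a"
  assumes "compact_quantum_group tens tensL tensR \<Delta>"
    and "haar_measure tens \<Delta> h"
    and "cqg_action tens \<Delta> tensB tensBL tensBR \<alpha>"
    and "\<And>i. tensor_map tensB tens_C_left (ev i) id (ev_id i)"
    and "\<And>i j. a i j = ev_id i (\<alpha> (char_cfun j))"
  shows "(ergodic tensB \<alpha> \<longleftrightarrow> (\<forall>i j. h (a i j) = 1 / of_nat CARD('x))) \<and>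
    ((\<forall>i j. h (a i j) = 1 / of_nat CARD('x)) \<longleftrightarrow> (\<forall>i j. a i j \<noteq> 0)) \<and>
    ((\<forall>i j. a i j \<noteq> 0) \<longleftrightarrow>
      (\<forall>\<psi>. invariant_state tensB \<alpha> \<psi> \<longrightarrow> (\<forall>i. \<psi> (char_cfun i) = 1 / of_nat CARD('x))))"
proof -
  have hom: "unital_star_hom \<alpha>"
    using assms(3) by (simp add: cqg_action_def)
  interpret cfun_tensor_slices tensB ev_id
    using assms(3,4)
    by (simp add: cfun_tensor_slices_def cfun_tensor_def cfun_tensor_slices_axioms_def
        cqg_action_def triple_tensor_def)
  interpret M: action_matrix a h
    by (rule action_matrix[OF hom assms(5,3,2)])
  let ?uniform = "\<forall>i j. h (a i j) = 1 / of_nat CARD('x)"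
  \<comment> \<open>The implications are (3) to (1) to (2) to (3), then (2) to (4) and (4) to
    (2).\<close>
  have "ergodic tensB \<alpha>" if "\<forall>i j. a i j \<noteq> 0"
    using that M.fixed_vector_const_if_nonzero
    unfolding ergodic_iff_fixed_vectors_const[OF hom assms(5)] by blast
  moreover have ?uniform if "ergodic tensB \<alpha>"
    using that M.h_uniform_if_fixed_vectors_const
    unfolding ergodic_iff_fixed_vectors_const[OF hom assms(5)] by blast
  moreover have "\<forall>i j. a i j \<noteq> 0" if ?uniform
    using that M.nonzero_if_h_uniform by blast
  moreover have "\<psi> (char_cfun i) = 1 / of_nat CARD('x)"
    if ?uniform "invariant_state tensB \<alpha> \<psi>" for \<psi> i
    using that M.invariant_uniform_if_h_uniform[of "\<lambda>i. \<psi> (char_cfun i)"] state_char_cfun_sum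
    unfolding invariant_state_iff[OF hom assms(5)] by blast
  moreover have ?uniform
    if inv: "\<And>\<psi> i. invariant_state tensB \<alpha> \<psi> \<Longrightarrow> \<psi> (char_cfun i) = 1 / of_nat CARD('x)"
  proof (intro allI)
    fix i j
    \<comment> \<open>The state given by row \<open>i\<close> of \<open>P\<close>; it is invariant
      by \<open>h_left\<close>, and its weights are the numbers to be determined.\<close>
    let ?\<psi> = "\<lambda>b. \<Sum>k\<in>UNIV. h (a i k) * eval_cfun b k"
    have char: "?\<psi> (char_cfun k) = h (a i k)" for k
      by (simp add: if_distrib cong: if_cong)
    have "state ?\<psi>"
      by (intro state_weighted_sum M.h_nonneg M.h_row_sum)
    then have "invariant_state tensB \<alpha> ?\<psi>"
      unfolding invariant_state_iff[OF hom assms(5)] char using M.h_left by blast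
    from inv[OF this, of j] show "h (a i j) = 1 / of_nat CARD('x)"
      unfolding char .
  qed
  ultimately show ?thesis by metis
qed

end
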